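(* Let $(\Omega,\mathcal{H},\mathbb{E})$ be a sublinear expectation space whose associated capacity $\mathbb{V}$ is upper continuous, with conjugate expectation $\mathcal{E}[X]:=-\mathbb{E}[-X]$. Let $\{X_i\}_{i=1}^\infty$ be a sequence in $\mathcal{H}$ satisfying: (i) $X_{i+1}$ is independent of $(X_1,\dots,X_i)$ under $\mathbb{E}$ for each $i=1,2,\dots$; (ii) $\mathbb{E}[X_i]=\overline{\mu}_i$ and $\mathcal{E}[X_i]=\underline{\mu}_i$, where $-\infty<\underline{\mu}_i\le\overline{\mu}_i<\infty$, for each $i\ge 1$; (iii) there are two constants $\overline{\mu}$ and $\underline{\mu}$ such that $$\lim_{n\to\infty}\frac1n\sum_{i=1}^n|\underline{\mu}_i-\underline{\mu}|=0,\qquad \lim_{n\to\infty}\frac1n\sum_{i=1}^n|\overline{\mu}_i-\overline{\mu}|=0;$$ (iv) $\sup_{i\ge1}\mathbb{E}[|X_i|^2]<\infty$. Then for every continuous function $\varphi:\mathbb{R}\to\mathbb{R}$ of linear growth, $$\mathbb{E}\left[\varphi\left(\frac1n\sum_{i=1}^nX_i\right)\right]\longrightarrow\sup_{\underline{\mu}\le y\le\overline{\mu}}\varphi(y)\qquad\text{as } n\to\infty.$$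
   Context: Sublinear expectation space: $\Omega$ is a set and $\mathcal{H}$ is a linear space of real-valued functions on $\Omega$ (the "random variables") containing all constants and such that $X\in\mathcal{H}$ implies $|X|\in\mathcal{H}$. A sublinear expectation is a functional $\mathbb{E}:\mathcal{H}\to\mathbb{R}$ such that for all $X,Y\in\mathcal{H}$: (a) $X\ge Y$ implies $\mathbb{E}[X]\ge\mathbb{E}[Y]$; (b) $\mathbb{E}[c]=c$ for every constant $c$; (c) $\mathbb{E}[X]-\mathbb{E}[Y]\le\mathbb{E}[X-Y]$; (d) $\mathbb{E}[\lambda X]=\lambda\mathbb{E}[X]$ for all $\lambda\ge0$. The triple $(\Omega,\mathcal{H},\mathbb{E})$ is then called a sublinear expectation space. Conjugate expectation: $\mathcal{E}[X]:=-\mathbb{E}[-X]$ for $X\in\mathcal{H}$. Capacities and standing assumption: $\mathcal{F}$ is a $\sigma$-algebra on $\Omega$, and $\mathbb{V}(A):=\mathbb{E}[I_A]$ for $A\in\mathcal{F}$ ($I_A$ the indicator function). It is assumed throughout that $\mathbb{V}$ is an upper continuous capacity: $\mathbb{V}(\emptyset)=0$, $\mathbb{V}(\Omega)=1$; $\mathbb{V}(A)\le\mathbb{V}(B)$ whenever $A\subset B$, $A,B\in\mathcal{F}$; and $\mathbb{V}(A_n)\downarrow\mathbb{V}(A)$ whenever $A_n\downarrow A$ with $A_n,A\in\mathcal{F}$. Independence: for $Y_1,\dots,Y_n\in\mathcal{H}$, $Y_n$ is independent of $X:=(Y_1,\dots,Y_{n-1})$ under $\mathbb{E}$ if for each measurable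 function $\varphi$ on $\mathbb{R}^n$ with $\varphi(X,Y_n)\in\mathcal{H}$ and $\varphi(x,Y_n)\in\mathcal{H}$ for each $x\in\mathbb{R}^{n-1}$, one has $\mathbb{E}[\varphi(X,Y_n)]=\mathbb{E}[\overline{\varphi}(X)]$, where $\overline{\varphi}(x):=\mathbb{E}[\varphi(x,Y_n)]$ and $\overline{\varphi}(X)\in\mathcal{H}$. Linear growth: there is a constant $C$ with $|\varphi(x)|\le C(1+|x|)$ for all $x\in\mathbb{R}$. Convention: the $X_i$ are $\mathcal{F}$-measurable, and $\mathcal{H}$ is understood to be rich enough to contain every function to which $\mathbb{E}$ is applied (indicators $I_A$ with $A\in\mathcal{F}$, the variables $|X_i|^2$, and continuous linear-growth or bounded Lipschitz functions of finitely many of the $X_i$). *)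

theory Defs
  imports "HOL-Analysis.Analysis"
begin

text \<open>
  The sample space is the type \<open>'w\<close>. A functional is a total function
  on \<open>'w \<Rightarrow> real\<close>, but only its values on \<open>H\<close> are constrained.
\<close>

locale sublinear_expectation_space =
  fixes H :: "('w \<Rightarrow> real) set"
    and E :: "('w \<Rightarrow> real) \<Rightarrow> real"
  assumes const_mem: "(\<lambda>_. c) \<in> H"
    and add_mem: "X \<in> H \<Longrightarrow> Y \<in> H \<Longrightarrow> (\<lambda>w. X w + Y w) \<in> H"
    and scale_mem: "X \<in> H \<Longrightarrow> (\<lambda>w. c * X w) \<in> H"
    and abs_mem: "X \<in> H \<Longrightarrow> (\<lambda>w. \<bar>X w\<bar>) \<in> H"
    and E_mono: "X \<in> H \<Longrightarrow> Y \<in> H \<Longrightarrow> (\<And>w. Y w \<le> X w) \<Longrightarrow> E Y \<le> E X"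
    and E_const: "E (\<lambda>_. c) = c"
    and E_sub: "X \<in> H \<Longrightarrow> Y \<in> H \<Longrightarrow> E X - E Y \<le> E (\<lambda>w. X w - Y w)"
    and E_scale: "X \<in> H \<Longrightarrow> 0 \<le> r \<Longrightarrow> E (\<lambda>w. r * X w) = r * E X"

definition conj_expectation :: "(('w \<Rightarrow> real) \<Rightarrow> real) \<Rightarrow> ('w \<Rightarrow> real) \<Rightarrow> real" where
  "conj_expectation E X = - E (\<lambda>w. - X w)"

definition capacity_of :: "(('w \<Rightarrow> real) \<Rightarrow> real) \<Rightarrow> 'w set \<Rightarrow> real" where
  "capacity_of E A = E (indicator A)"

definition upper_continuous_capacity :: "'w set set \<Rightarrow> ('w set \<Rightarrow> real) \<Rightarrow> bool" where
  "upper_continuous_capacity F V \<longleftrightarrow>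
     V {} = 0 \<and> V UNIV = 1 \<and>
     (\<forall>A\<in>F. \<forall>B\<in>F. A \<subseteq> B \<longrightarrow> V A \<le> V B) \<and>
     (\<forall>A :: nat \<Rightarrow> 'w set. range A \<subseteq> F \<longrightarrow> decseq A \<longrightarrow> (\<Inter>n. A n) \<in> F \<longrightarrow>
        (\<lambda>n. V (A n)) \<longlonglongrightarrow> V (\<Inter>n. A n))"

text \<open>
  \<open>Y n\<close> is independent of \<open>(Y 1, \<dots>, Y (n - 1))\<close>. Points of $\mathbb{R}^n$ are the
  extensional functions on \<open>{1..n}\<close>, so that \<open>x(n := y)\<close> is the point \<open>(x, y)\<close> for
  a point \<open>x\<close> of $\mathbb{R}^{n-1}$. That $\overline{\varphi}(Y_1,\dots,Y_{n-1})$ lies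
  in \<open>H\<close> is part of what independence asserts.
\<close>

definition indep_of_previous ::
    "('w \<Rightarrow> real) set \<Rightarrow> (('w \<Rightarrow> real) \<Rightarrow> real) \<Rightarrow> (nat \<Rightarrow> 'w \<Rightarrow> real) \<Rightarrow> nat \<Rightarrow> bool" where
  "indep_of_previous H E Y n \<longleftrightarrow>
     (\<forall>\<phi> \<in> borel_measurable (Pi\<^sub>M {1..n} (\<lambda>_. borel :: real measure)).
        (\<lambda>w. \<phi> (\<lambda>j\<in>{1..n}. Y j w)) \<in> H \<longrightarrow>
        (\<forall>x \<in> extensional {1..<n}. (\<lambda>w. \<phi> (x(n := Y n w))) \<in> H) \<longrightarrow>
        (let \<phi>bar = (\<lambda>x. E (\<lambda>w. \<phi> (x(n := Y n w))));
             \<phi>barX = (\<lambda>w. \<phi>bar (\<lambda>j\<in>{1..<n}. Y j w))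
         in \<phi>barX \<in> H \<and> E (\<lambda>w. \<phi> (\<lambda>j\<in>{1..n}. Y j w)) = E \<phi>barX))"

definition linear_growth :: "(real \<Rightarrow> real) \<Rightarrow> bool" where
  "linear_growth \<phi> \<longleftrightarrow> (\<exists>C. \<forall>x. \<bar>\<phi> x\<bar> \<le> C * (1 + \<bar>x\<bar>))"

text \<open>
  The richness convention on \<open>H\<close>. Bounded Lipschitz functions of finitely many of the
  variables are covered by the last clause, in which \<open>L2_set x {1..n}\<close> is the
  Euclidean norm of \<open>x\<close>.
\<close>

definition rich_for ::
    "'w set set \<Rightarrow> ('w \<Rightarrow> real) set \<Rightarrow> (nat \<Rightarrow> 'w \<Rightarrow> real) \<Rightarrow> bool" where
  "rich_for F H X \<longleftrightarrow>
     (\<forall>A\<in>F. indicator A \<in> H) \<and>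
     (\<forall>i\<ge>1. (\<lambda>w. \<bar>X i w\<bar>\<^sup>2) \<in> H) \<and>
     (\<forall>n \<psi>. continuous_map (powertop_real {1..n}) euclideanreal \<psi> \<longrightarrow>
        (\<exists>C. \<forall>x \<in> extensional {1..n}. \<bar>\<psi> x\<bar> \<le> C * (1 + L2_set x {1..n})) \<longrightarrow>
        (\<lambda>w. \<psi> (\<lambda>j\<in>{1..n}. X j w)) \<in> H)"

end

theory Submission
  imports Defs
begin

text \<open>
  Let $S_n = X_1 + \dots + X_n$ and let $I_n$ be the interval between
  $\sum_{i \le n} \underline{\mu}_i$ and $\sum_{i \le n} \overline{\mu}_i$. If $p$ is the
  point of $I_k$ nearest to $t$ and $q$ is the mean of $X_{k+1}$, upper or lower according
  to the sign of $t - p$, then the first-order term $(t - p)(X_{k+1} - q)$ has upper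
  expectation $0$. So, by independence, the expected
  squared distance of $S_k$ to $I_k$ grows by a bounded amount per step, and $S_n / n$ is within
  $O(n^{-1/2})$ of $I_n / n$ in mean. A continuous function of linear growth exceeds its maximum
  over $[\underline{\mu}, \overline{\mu}]$ by at most $\epsilon + K \cdot \mathrm{dist}$, which is the
  upper bound. For the lower bound, fix a maximiser $y$ and replace $I_n$ by the sum of the
  points of $[\underline{\mu}_i, \overline{\mu}_i]$ that divide these intervals in the same ratio
  as $y$ divides $[\underline{\mu}, \overline{\mu}]$: the first-order terms, with either sign, then have
  nonnegative upper expectation.
\<close>

section \<open>Functions of linear growth and majorants built from the distance to an
  interval\<close>

lemma linear_growth_shift:
  assumes "linear_growth f"
  shows "linear_growth (\<lambda>x. f (t + x))"
proof -
  obtain C where C: "\<And>x. \<bar>f x\<bar> \<le> C * (1 + \<bar>x\<bar>)"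
    using assms unfolding linear_growth_def by blast
  have C0: "0 \<le> C" using C[of 0] by (simp add: abs_le_iff)
  have "\<bar>f (t + x)\<bar> \<le> (C * (1 + \<bar>t\<bar>)) * (1 + \<bar>x\<bar>)" for x
  proof -
    have "\<bar>f (t + x)\<bar> \<le> C * (1 + \<bar>t + x\<bar>)" by (rule C)
    also have "\<dots> \<le> C * ((1 + \<bar>t\<bar>) * (1 + \<bar>x\<bar>))"
    proof (rule mult_left_mono[OF _ C0])
      have "0 \<le> \<bar>t\<bar> * \<bar>x\<bar>" by simp
      moreover have "(1 + \<bar>t\<bar>) * (1 + \<bar>x\<bar>) = 1 + \<bar>t\<bar> + \<bar>x\<bar> + \<bar>t\<bar> * \<bar>x\<bar>"
        by (simp add: algebra_simps)
      ultimately show "1 + \<bar>t + x\<bar> \<le> (1 + \<bar>t\<bar>) * (1 + \<bar>x\<bar>)"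
        using abs_triangle_ineq[of t x] by linarith
    qed
    finally show ?thesis by (simp add: mult.assoc)
  qed
  then show ?thesis unfolding linear_growth_def by blast
qed

lemma linear_growth_scale:
  assumes "linear_growth f"
  shows "linear_growth (\<lambda>x. f (c * x))"
proof -
  obtain C where C: "\<And>x. \<bar>f x\<bar> \<le> C * (1 + \<bar>x\<bar>)"
    using assms unfolding linear_growth_def by blast
  have C0: "0 \<le> C" using C[of 0] by (simp add: abs_le_iff)
  have "\<bar>f (c * x)\<bar> \<le> (C * (1 + \<bar>c\<bar>)) * (1 + \<bar>x\<bar>)" for x
  proof -
    have "\<bar>f (c * x)\<bar> \<le> C * (1 + \<bar>c * x\<bar>)" by (rule C)
    also have "\<dots> \<le> C * ((1 + \<bar>c\<bar>) * (1 + \<bar>x\<bar>))"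
      by (rule mult_left_mono[OF _ C0]) (simp add: algebra_simps abs_mult)
    finally show ?thesis by (simp add: mult.assoc)
  qed
  then show ?thesis unfolding linear_growth_def by blast
qed

lemma linear_growth_minus: "linear_growth f \<Longrightarrow> linear_growth (\<lambda>x. - f x)"
  by (simp add: linear_growth_def)

lemma infdist_interval_attained:
  fixes a b t :: real
  assumes "a \<le> b"
  obtains p where "p \<in> {a..b}" "infdist t {a..b} = \<bar>t - p\<bar>"
  using infdist_attains_inf[of "{a..b}" t] assms by (auto simp: dist_real_def)

text \<open>Near the interval, uniform continuity costs at most \<open>e\<close>; far from it,
  linear growth is absorbed into a multiple of the distance. Applied to a negated function and
  \<open>{y..y}\<close>, it also gives a minorant around a single point.\<close>

lemma majorant_infdist:
  fixes \<phi> :: "real \<Rightarrow> real"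
  assumes cont: "continuous_on UNIV \<phi>" and growth: "linear_growth \<phi>"
    and ab: "a \<le> b" and M: "\<And>y. y \<in> {a..b} \<Longrightarrow> \<phi> y \<le> M" and e: "0 < e"
  obtains K where "0 \<le> K" "\<And>y. \<phi> y \<le> M + e + K * infdist y {a..b}"
proof -
  obtain C where C: "\<And>x. \<bar>\<phi> x\<bar> \<le> C * (1 + \<bar>x\<bar>)"
    using growth unfolding linear_growth_def by blast
  have C0: "0 \<le> C" using C[of 0] by (simp add: abs_le_iff)
  \<comment> \<open>Widening by 1 on each side makes the interval contain every point within
    \<open>d\<close> \<le> 1 of its nearest point \<open>p\<close>.\<close>
  have "uniformly_continuous_on {a-1..b+1} \<phi>"
    by (rule compact_uniformly_continuous) (auto intro: continuous_on_subset[OF cont])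
  then obtain d0 where d0: "0 < d0"
    and uc: "\<And>x y. x \<in> {a-1..b+1} \<Longrightarrow> y \<in> {a-1..b+1} \<Longrightarrow> dist y x < d0 \<Longrightarrow> dist (\<phi> y) (\<phi> x) < e"
    unfolding uniformly_continuous_on_def using e by metis
  define d where "d = min 1 d0"
  have d: "0 < d" "d \<le> 1" "d \<le> d0" using d0 by (auto simp: d_def)
  define L where "L = C * (1 + \<bar>a\<bar> + \<bar>b\<bar>) + \<bar>M\<bar>"
  have L0: "0 \<le> L" using C0 by (simp add: L_def)
  have "\<phi> y \<le> M + e + (C + L / d) * infdist y {a..b}" for y
  proof -
    obtain p where p: "p \<in> {a..b}" and yp: "infdist y {a..b} = \<bar>y - p\<bar>"
      using infdist_interval_attained[OF ab] by blast
    show ?thesis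
    proof (cases "\<bar>y - p\<bar> < d")
      case True
      have "dist (\<phi> y) (\<phi> p) < e"
        by (rule uc) (use True p d in \<open>auto simp: dist_real_def\<close>)
      then have "\<phi> y \<le> M + e" using M[OF p] by (simp add: dist_real_def)
      moreover have "0 \<le> (C + L / d) * infdist y {a..b}" using C0 L0 d
        by (simp add: infdist_nonneg)
      ultimately show ?thesis by linarith
    next
      case False
      \<comment> \<open>The distance is at least \<open>d\<close> here, so the distance term pays
        for the constant \<open>L\<close>; the summand \<open>\<bar>M\<bar>\<close> of
        \<open>L\<close> covers a negative \<open>M\<close>.\<close>
      have "L * 1 \<le> L * (\<bar>y - p\<bar> / d)" using False d by (intro mult_left_mono L0) simp
      moreover have "\<phi> y \<le> C * (1 + \<bar>y\<bar>)" using C[of y] by linarith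
      moreover have "C * (1 + \<bar>y\<bar>) \<le> C * (1 + \<bar>a\<bar> + \<bar>b\<bar> + \<bar>y - p\<bar>)"
        using p by (intro mult_left_mono C0) auto
      moreover have "C * (1 + \<bar>a\<bar> + \<bar>b\<bar> + \<bar>y - p\<bar>) = L - \<bar>M\<bar> + C * \<bar>y - p\<bar>"
        by (simp add: L_def algebra_simps)
      moreover have "(C + L / d) * \<bar>y - p\<bar> = C * \<bar>y - p\<bar> + L * (\<bar>y - p\<bar> / d)"
        by (simp add: algebra_simps)
      ultimately show ?thesis using e unfolding yp by linarith
    qed
  qed
  then show ?thesis using C0 L0 d by (intro that[of "C + L / d"]) auto
qed

section \<open>A linear-growth surrogate for the squared distance\<close>

text \<open>
  The square of a partial sum need not lie in \<open>H\<close>, so the squared distance to \<open>S\<close> is replaced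
  by a function of linear growth whose second-order increments are still at most quadratic.
\<close>

definition soft_dist :: "real \<Rightarrow> real set \<Rightarrow> real \<Rightarrow> real" where
  "soft_dist c S t = sqrt (c\<^sup>2 + (infdist t S)\<^sup>2)"

lemma infdist_le_soft_dist: "infdist t S \<le> soft_dist c S t"
  unfolding soft_dist_def by (rule real_le_rsqrt) simp

lemma continuous_on_soft_dist: "continuous_on UNIV (soft_dist c S)"
  unfolding soft_dist_def by (intro continuous_intros)

lemma linear_growth_soft_dist:
  assumes "S \<noteq> {}"
  shows "linear_growth (soft_dist c S)"
proof -
  obtain a where a: "a \<in> S" using assms by blast
  have "\<bar>soft_dist c S x\<bar> \<le> (1 + \<bar>c\<bar> + \<bar>a\<bar>) * (1 + \<bar>x\<bar>)" for x
  proof -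
    have "soft_dist c S x \<le> \<bar>c\<bar> + infdist x S"
      using sqrt_sum_squares_le_sum_abs[of c "infdist x S"]
      by (simp add: soft_dist_def infdist_nonneg)
    also have "infdist x S \<le> \<bar>x\<bar> + \<bar>a\<bar>"
      using infdist_le[OF a, of x] by (simp add: dist_real_def)
    finally have "soft_dist c S x \<le> \<bar>c\<bar> + \<bar>x\<bar> + \<bar>a\<bar>" by simp
    moreover have "0 \<le> (\<bar>c\<bar> + \<bar>a\<bar>) * \<bar>x\<bar>" by simp
    moreover have "0 \<le> soft_dist c S x" by (simp add: soft_dist_def)
    moreover have "(1 + \<bar>c\<bar> + \<bar>a\<bar>) * (1 + \<bar>x\<bar>) = 1 + \<bar>c\<bar> + \<bar>a\<bar> + \<bar>x\<bar> + (\<bar>c\<bar> + \<bar>a\<bar>) * \<bar>x\<bar>"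
      by (simp add: algebra_simps)
    ultimately show ?thesis by linarith
  qed
  then show ?thesis unfolding linear_growth_def by blast
qed

text \<open>The square root lies below its tangent at \<open>u\<^sup>2\<close>. Replacing
  \<open>u\<close> by the smaller \<open>c\<close> in the quadratic remainder makes that remainder
  uniform in \<open>s\<close>.\<close>

lemma sqrt_sq_add_le:
  fixes s y c u :: real
  assumes c: "0 < c" and u: "u = sqrt (c\<^sup>2 + s\<^sup>2)"
  shows "sqrt (c\<^sup>2 + (s + y)\<^sup>2) \<le> u + (s / u) * y + y\<^sup>2 / (2 * c)"
proof -
  have uc: "c \<le> u" using c unfolding u by (intro real_le_rsqrt) simp
  then have u0: "0 < u" using c by linarith
  have uu: "u\<^sup>2 = c\<^sup>2 + s\<^sup>2" unfolding u by simp
  have "c\<^sup>2 + (s + y)\<^sup>2 = u\<^sup>2 + (2 * s * y + y\<^sup>2)"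
    by (simp add: uu power2_sum)
  \<comment> \<open>The two sides differ by the square of the correction term.\<close>
  also have "\<dots> \<le> (u + (2 * s * y + y\<^sup>2) / (2 * u))\<^sup>2"
    using u0 by (simp add: power2_sum)
  finally have le: "c\<^sup>2 + (s + y)\<^sup>2 \<le> (u + (2 * s * y + y\<^sup>2) / (2 * u))\<^sup>2" .
  \<comment> \<open>In this form the right-hand side is visibly nonnegative, as
    \<open>real_le_lsqrt\<close> demands.\<close>
  have "u + (2 * s * y + y\<^sup>2) / (2 * u) = (u\<^sup>2 + (c\<^sup>2 + (s + y)\<^sup>2)) / (2 * u)"
    using u0 uu by (simp add: field_simps power2_eq_square)
  then have "0 \<le> u + (2 * s * y + y\<^sup>2) / (2 * u)" using u0 by simp
  then have "sqrt (c\<^sup>2 + (s + y)\<^sup>2) \<le> u + (2 * s * y + y\<^sup>2) / (2 * u)"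
    using le by (rule real_le_lsqrt)
  also have "\<dots> = u + (s / u) * y + y\<^sup>2 / (2 * u)"
    using u0 by (simp add: field_simps)
  also have "y\<^sup>2 / (2 * u) \<le> y\<^sup>2 / (2 * c)"
    using uc c by (intro divide_left_mono) auto
  finally show ?thesis by simp
qed

text \<open>The distance to \<open>S\<close> is at most the distance to its point
  \<open>p + q\<close>. What remains is a term linear in \<open>x - q\<close>, whose expectation is
  controlled by the choice of \<open>q\<close>, and a remainder that involves only squares of
  \<open>x\<close> and \<open>q\<close>.\<close>

lemma soft_dist_step:
  assumes c: "0 < c" and "p + q \<in> S" "u = sqrt (c\<^sup>2 + (t - p)\<^sup>2)"
  shows "soft_dist c S (t + x) \<le> u + ((t - p) / u) * (x - q) + (x\<^sup>2 + q\<^sup>2) / c"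
proof -
  have "infdist (t + x) S \<le> \<bar>(t - p) + (x - q)\<bar>"
    using infdist_le[OF assms(2), of "t + x"] by (simp add: dist_real_def algebra_simps)
  then have "(infdist (t + x) S)\<^sup>2 \<le> ((t - p) + (x - q))\<^sup>2"
    by (metis infdist_nonneg power2_abs power_mono)
  then have "soft_dist c S (t + x) \<le> sqrt (c\<^sup>2 + ((t - p) + (x - q))\<^sup>2)"
    unfolding soft_dist_def by simp
  also have "\<dots> \<le> u + ((t - p) / u) * (x - q) + (x - q)\<^sup>2 / (2 * c)"
    by (rule sqrt_sq_add_le) (use assms in auto)
  also have "(x - q)\<^sup>2 / (2 * c) \<le> (x\<^sup>2 + q\<^sup>2) / c"
  proof -
    have "0 \<le> (x + q)\<^sup>2" by simp
    then have "(x - q)\<^sup>2 \<le> 2 * (x\<^sup>2 + q\<^sup>2)"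
      by (simp add: power2_sum power2_diff)
    then have "(x - q)\<^sup>2 / (2 * c) \<le> (2 * (x\<^sup>2 + q\<^sup>2)) / (2 * c)"
      using c by (intro divide_right_mono) auto
    then show ?thesis unfolding mult_divide_mult_cancel_left[OF zero_neq_numeral[symmetric]] .
  qed
  finally show ?thesis by simp
qed

text \<open>Triangle inequality along \<open>t / n\<close>, \<open>p / n\<close> and the projection
  of \<open>p / n\<close> onto \<open>{a..b}\<close>, with \<open>p\<close> nearest to
  \<open>t\<close> among the points between the two sums. The last leg is bounded by the averaged
  deviations of hypothesis (iii).\<close>

lemma infdist_mean_le:
  fixes a b t :: real and al bu :: "nat \<Rightarrow> real"
  assumes n: "n \<ge> 1" and ab: "a \<le> b" and le: "(\<Sum>i=1..n. al i) \<le> (\<Sum>i=1..n. bu i)"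
  shows "infdist ((1 / real n) * t) {a..b}
    \<le> (1 / real n) * (\<Sum>i=1..n. \<bar>al i - a\<bar>) + (1 / real n) * (\<Sum>i=1..n. \<bar>bu i - b\<bar>)
      + soft_dist c {(\<Sum>i=1..n. al i)..(\<Sum>i=1..n. bu i)} t / real n"
proof -
  obtain p where p: "p \<in> {(\<Sum>i=1..n. al i)..(\<Sum>i=1..n. bu i)}"
    and tp: "infdist t {(\<Sum>i=1..n. al i)..(\<Sum>i=1..n. bu i)} = \<bar>t - p\<bar>"
    using infdist_interval_attained[OF le] by blast
  have mean: "\<bar>(\<Sum>i=1..n. x i) / real n - z\<bar> \<le> (1 / real n) * (\<Sum>i=1..n. \<bar>x i - z\<bar>)"
    for x :: "nat \<Rightarrow> real" and z
  proof -
    have "(\<Sum>i=1..n. x i) / real n - z = (\<Sum>i=1..n. x i - z) / real n"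
      using n by (simp add: sum_subtractf diff_divide_distrib)
    also have "\<bar>\<dots>\<bar> \<le> (\<Sum>i=1..n. \<bar>x i - z\<bar>) / real n"
      by (simp add: divide_right_mono)
    finally show ?thesis by simp
  qed
  have bnd: "(\<Sum>i=1..n. al i) / real n \<le> p / real n" "p / real n \<le> (\<Sum>i=1..n. bu i) / real n"
    using p by (auto intro: divide_right_mono)
  \<comment> \<open>\<open>p / n\<close> can leave \<open>{a..b}\<close> only as far as the averaged
    endpoints do.\<close>
  define p' where "p' = max a (min b (p / real n))"
  have p': "p' \<in> {a..b}" using ab by (simp add: p'_def)
  have "\<bar>p / real n - p'\<bar> \<le> \<bar>(\<Sum>i=1..n. al i) / real n - a\<bar> + \<bar>(\<Sum>i=1..n. bu i) / real n - b\<bar>"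
    using bnd unfolding p'_def by linarith
  moreover have "infdist ((1 / real n) * t) {a..b} \<le> \<bar>t / real n - p'\<bar>"
    using infdist_le[OF p', of "t / real n"] by (simp add: dist_real_def)
  moreover have "\<bar>t / real n - p / real n\<bar> = \<bar>t - p\<bar> / real n"
    by (simp flip: diff_divide_distrib)
  moreover have "\<bar>t - p\<bar> / real n \<le> soft_dist c {(\<Sum>i=1..n. al i)..(\<Sum>i=1..n. bu i)} t / real n"
    using infdist_le_soft_dist tp by (metis divide_right_mono of_nat_0_le_iff)
  ultimately show ?thesis using mean[of al a] mean[of bu b] by linarith
qed

text \<open>Serves the choice \<open>c = sqrt (real n)\<close>, which gives both summands of
  \<open>c + n * (s / c)\<close> the order of \<open>sqrt (real n)\<close>.\<close>

lemma sqrt_scaling: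
  assumes "n \<ge> 1"
  shows "(K / real n) * (sqrt (real n) + real n * (s / sqrt (real n))) = K * ((1 + s) / sqrt (real n))"
proof -
  have "real n = sqrt (real n) * sqrt (real n)" "0 < sqrt (real n)" using assms by auto
  then obtain v where "real n = v * v" "sqrt (real n) = v" "0 < v" by blast
  then show ?thesis by (simp add: field_simps)
qed

section \<open>Consequences of sublinearity\<close>

context sublinear_expectation_space
begin

lemma uminus_mem: "X \<in> H \<Longrightarrow> (\<lambda>w. - X w) \<in> H"
  using scale_mem[of X "-1"] by simp

lemma E_add_le:
  assumes "X \<in> H" "Y \<in> H"
  shows "E (\<lambda>w. X w + Y w) \<le> E X + E Y"
  using E_sub[OF add_mem[OF assms] assms(2)] by simp

lemma E_add_const:
  assumes "X \<in> H"
  shows "E (\<lambda>w. X w + c) = E X + c"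
proof (rule antisym)
  show "E (\<lambda>w. X w + c) \<le> E X + c"
    using E_add_le[OF assms const_mem] by (simp add: E_const)
  have "E (\<lambda>w. (X w + c) + - c) \<le> E (\<lambda>w. X w + c) + - c"
    using E_add_le[OF add_mem[OF assms const_mem] const_mem, of c "- c"] by (simp add: E_const)
  then show "E X + c \<le> E (\<lambda>w. X w + c)" by simp
qed

lemma E_affine:
  assumes "Z \<in> H" "0 \<le> r"
  shows "E (\<lambda>w. a + r * Z w) = a + r * E Z"
  using E_add_const[OF scale_mem[OF assms(1)], of r a] E_scale[OF assms]
  by (simp add: add.commute)

lemma E_affine_le:
  assumes "Z \<in> H" "E Z \<le> b" "0 \<le> r"
  shows "E (\<lambda>w. a + r * Z w) \<le> a + r * b"
  using assms by (simp add: E_affine mult_left_mono)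

text \<open>For \<open>r\<close> \<ge> 0 the value is \<open>r\<close> times the gap from
  \<open>q\<close> to the upper mean, for \<open>r < 0\<close> it is \<open>- r\<close> times the
  gap from the lower mean to \<open>q\<close>.\<close>

lemma E_centered_ge:
  assumes "X \<in> H" "conj_expectation E X \<le> q" "q \<le> E X"
  shows "0 \<le> E (\<lambda>w. r * (X w - q))"
proof (cases "0 \<le> r")
  case True
  have "(\<lambda>w. X w - q) \<in> H" using add_mem[OF assms(1) const_mem, of "- q"] by simp
  moreover have "E (\<lambda>w. X w - q) = E X - q" using E_add_const[OF assms(1), of "- q"] by simp
  ultimately show ?thesis using E_scale[of "\<lambda>w. X w - q" r] True assms by simp
next
  case False
  have "(\<lambda>w. - X w + q) \<in> H" using add_mem[OF uminus_mem[OF assms(1)] const_mem] .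
  moreover have "E (\<lambda>w. - X w + q) = E (\<lambda>w. - X w) + q"
    using E_add_const[OF uminus_mem[OF assms(1)]] .
  ultimately have "E (\<lambda>w. (- r) * (- X w + q)) = (- r) * (E (\<lambda>w. - X w) + q)"
    using E_scale[of "\<lambda>w. - X w + q" "- r"] False by simp
  moreover have "0 \<le> (- r) * (E (\<lambda>w. - X w) + q)"
    using False assms unfolding conj_expectation_def by (intro mult_nonneg_nonneg) auto
  moreover have "(\<lambda>w. (- r) * (- X w + q)) = (\<lambda>w. r * (X w - q))"
    by (auto simp: algebra_simps)
  ultimately show ?thesis by simp
qed

text \<open>The sign of \<open>r\<close> decides which of the two means enters the expectation, so
  centring at that one cancels the first-order term exactly.\<close>

lemma E_centered_extreme:
  assumes "X \<in> H" and q: "q = (if 0 \<le> r then E X else conj_expectation E X)"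
  shows "E (\<lambda>w. r * (X w - q)) = 0"
proof (cases "0 \<le> r")
  case True
  have "(\<lambda>w. X w - q) \<in> H" using add_mem[OF assms(1) const_mem, of "- q"] by simp
  moreover have "E (\<lambda>w. X w - q) = 0" using E_add_const[OF assms(1), of "- q"] True q by simp
  ultimately show ?thesis using E_scale[of "\<lambda>w. X w - q" r] True by simp
next
  case False
  have "(\<lambda>w. - X w + q) \<in> H" using add_mem[OF uminus_mem[OF assms(1)] const_mem] .
  moreover have "E (\<lambda>w. - X w + q) = 0"
    unfolding E_add_const[OF uminus_mem[OF assms(1)]] using False q by (simp add: conj_expectation_def)
  ultimately have "E (\<lambda>w. (- r) * (- X w + q)) = 0"
    using E_scale[of "\<lambda>w. - X w + q" "- r"] False by simp
  moreover have "(\<lambda>w. (- r) * (- X w + q)) = (\<lambda>w. r * (X w - q))"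
    by (auto simp: algebra_simps)
  ultimately show ?thesis by simp
qed

end

section \<open>The independent sequence and membership in \<open>H\<close>\<close>

text \<open>\<open>M\<close> stands for any bound on the second moments in (iv). Indices start at 1,
  so independence is assumed from \<open>X 2\<close> on.\<close>

locale independent_sequence = sublinear_expectation_space H E
  for H :: "('w \<Rightarrow> real) set" and E :: "('w \<Rightarrow> real) \<Rightarrow> real" +
  fixes F :: "'w set set" and X :: "nat \<Rightarrow> 'w \<Rightarrow> real"
    and \<mu>l \<mu>u :: "nat \<Rightarrow> real" and M :: real
  assumes X_mem: "i \<ge> 1 \<Longrightarrow> X i \<in> H"
    and rich: "rich_for F H X"
    and indep: "i \<ge> 1 \<Longrightarrow> indep_of_previous H E X (Suc i)"
    and upper_mean: "i \<ge> 1 \<Longrightarrow> E (X i) = \<mu>u i"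
    and lower_mean: "i \<ge> 1 \<Longrightarrow> conj_expectation E (X i) = \<mu>l i"
    and means_le: "i \<ge> 1 \<Longrightarrow> \<mu>l i \<le> \<mu>u i"
    and second_moment: "i \<ge> 1 \<Longrightarrow> E (\<lambda>w. (X i w)\<^sup>2) \<le> M"
begin

lemma sq_mem: "i \<ge> 1 \<Longrightarrow> (\<lambda>w. (X i w)\<^sup>2) \<in> H"
  using rich unfolding rich_for_def by simp

text \<open>Since \<open>X i\<close> and its negative are at most \<open>1 + (X i)\<^sup>2\<close>,
  both means lie within \<open>1 + M\<close> of 0. Centring at any admissible \<open>q\<close> thus
  has a bounded cost.\<close>

lemma mean_sq_le:
  assumes "i \<ge> 1" "q \<in> {\<mu>l i..\<mu>u i}"
  shows "q\<^sup>2 \<le> (1 + M)\<^sup>2"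
proof -
  have *: "E (\<lambda>w. a * X i w) \<le> 1 + M" if "\<bar>a\<bar> = 1" for a
  proof -
    have "E (\<lambda>w. a * X i w) \<le> E (\<lambda>w. 1 + 1 * (X i w)\<^sup>2)"
    proof (rule E_mono)
      show "(\<lambda>w. 1 + 1 * (X i w)\<^sup>2) \<in> H"
        using add_mem[OF const_mem sq_mem[OF assms(1)]] by simp
      show "(\<lambda>w. a * X i w) \<in> H" using scale_mem[OF X_mem[OF assms(1)]] .
      fix w
      \<comment> \<open>With \<open>a\<^sup>2 = 1\<close>, expanding gives \<open>a * X i w\<close>
        \<le> \<open>(X i w)\<^sup>2 + 1/4\<close>.\<close>
      have "0 \<le> (a * X i w - 1/2)\<^sup>2" by simp
      moreover have "a\<^sup>2 = 1" using that by (metis power2_abs one_power2)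
      ultimately show "a * X i w \<le> 1 + 1 * (X i w)\<^sup>2"
        by (simp add: power2_diff power_mult_distrib power_divide)
    qed
    also have "\<dots> \<le> 1 + 1 * M"
      by (rule E_affine_le[OF sq_mem[OF assms(1)] second_moment[OF assms(1)]]) simp
    finally show ?thesis by simp
  qed
  have "\<mu>u i \<le> 1 + M" using *[of 1] upper_mean[OF assms(1)] by simp
  moreover have "- (1 + M) \<le> \<mu>l i"
    using *[of "-1"] lower_mean[OF assms(1)] by (simp add: conj_expectation_def)
  ultimately have "\<bar>q\<bar> \<le> 1 + M" using assms(2) by auto
  then show ?thesis by (metis abs_ge_zero power2_abs power_mono)
qed

text \<open>The last clause of \<open>rich_for\<close> applies because a sum over \<open>J\<close>
  is at most \<open>card J\<close> times the Euclidean norm. A general \<open>J\<close> serves both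
  the partial sums and the single variables.\<close>

lemma sum_mem:
  assumes f: "continuous_on UNIV f" "linear_growth f" and J: "J \<subseteq> {1..n}"
  shows "(\<lambda>w. f (\<Sum>j\<in>J. X j w)) \<in> H"
proof -
  obtain C where C: "\<And>x. \<bar>f x\<bar> \<le> C * (1 + \<bar>x\<bar>)"
    using f(2) unfolding linear_growth_def by blast
  have C0: "0 \<le> C" using C[of 0] by (simp add: abs_le_iff)
  let ?\<psi> = "\<lambda>x. f (\<Sum>j\<in>J. x j)"
  have "continuous_map (powertop_real {1..n}) euclideanreal (\<lambda>x. \<Sum>j\<in>J. x j)"
    using J finite_subset[OF J]
    by (intro continuous_map_sum continuous_map_product_projection) auto
  then have "continuous_map (powertop_real {1..n}) euclideanreal (f \<circ> (\<lambda>x. \<Sum>j\<in>J. x j))"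
    using f(1) by (intro continuous_map_compose[of _ euclideanreal]) auto
  then have cont: "continuous_map (powertop_real {1..n}) euclideanreal ?\<psi>"
    by (simp add: o_def)
  have "\<bar>?\<psi> x\<bar> \<le> (C * (1 + real (card J))) * (1 + L2_set x {1..n})" for x
  proof -
    have L0: "0 \<le> L2_set x {1..n}" by (rule L2_set_nonneg)
    have "\<bar>\<Sum>j\<in>J. x j\<bar> \<le> (\<Sum>j\<in>J. \<bar>x j\<bar>)" by (rule sum_abs)
    also have "\<dots> \<le> real (card J) * L2_set x {1..n}"
    proof (rule sum_bounded_above)
      fix j assume "j \<in> J"
      then have "\<bar>x j\<bar> \<le> L2_set (\<lambda>i. \<bar>x i\<bar>) {1..n}"
        using J by (intro member_le_L2_set) auto
      then show "\<bar>x j\<bar> \<le> L2_set x {1..n}" by (simp add: L2_set_def)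
    qed
    finally have "1 + \<bar>\<Sum>j\<in>J. x j\<bar> \<le> (1 + real (card J)) * (1 + L2_set x {1..n})"
      using L0 by (simp only: ring_distribs)
    then have "C * (1 + \<bar>\<Sum>j\<in>J. x j\<bar>) \<le> C * ((1 + real (card J)) * (1 + L2_set x {1..n}))"
      by (rule mult_left_mono[OF _ C0])
    then show ?thesis using C[of "\<Sum>j\<in>J. x j"] by (simp add: mult.assoc)
  qed
  then have "(\<lambda>w. ?\<psi> (\<lambda>j\<in>{1..n}. X j w)) \<in> H"
    using rich cont unfolding rich_for_def by blast
  moreover have "(\<Sum>j\<in>J. (\<lambda>j\<in>{1..n}. X j w) j) = (\<Sum>j\<in>J. X j w)" for w
    using J by (intro sum.cong) auto
  ultimately show ?thesis by simp
qed

lemma partial_sum_mem: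
  assumes "continuous_on UNIV f" "linear_growth f"
  shows "(\<lambda>w. f (\<Sum>i=1..n. X i w)) \<in> H"
  using sum_mem[OF assms, of "{1..n}" n] by simp

lemma mean_mem:
  assumes "continuous_on UNIV f" "linear_growth f"
  shows "(\<lambda>w. f (c * (\<Sum>i=1..n. X i w))) \<in> H"
proof -
  have "continuous_on UNIV (\<lambda>x. f (c * x))"
    by (rule continuous_on_compose2[OF assms(1)]) (auto intro!: continuous_intros)
  from partial_sum_mem[OF this linear_growth_scale[OF assms(2)]] show ?thesis .
qed

lemma shifted_mem:
  assumes "continuous_on UNIV f" "linear_growth f" "i \<ge> 1"
  shows "(\<lambda>w. f (t + X i w)) \<in> H"
proof -
  have "continuous_on UNIV (\<lambda>x. f (t + x))"
    by (rule continuous_on_compose2[OF assms(1)]) (auto intro!: continuous_intros)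
  from sum_mem[OF this linear_growth_shift[OF assms(2)], of "{i}" i] assms(3)
  show ?thesis by simp
qed

section \<open>Conditioning on the past, one step at a time\<close>

text \<open>Independence is applied to \<open>f\<close> of the sum of the coordinates; freezing the
  first \<open>k\<close> of them turns it into \<open>g\<close>. Membership of \<open>g\<close> of
  the partial sum in \<open>H\<close> is part of independence, and no continuity of \<open>g\<close>
  is established.\<close>

lemma partial_sum_step:
  fixes k :: nat
  assumes f: "continuous_on UNIV f" "linear_growth f"
  defines "g \<equiv> \<lambda>t. E (\<lambda>w. f (t + X (Suc k) w))"
  shows "(\<lambda>w. g (\<Sum>i=1..k. X i w)) \<in> H"
    and "E (\<lambda>w. f (\<Sum>i=1..Suc k. X i w)) = E (\<lambda>w. g (\<Sum>i=1..k. X i w))"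
proof -
  have "(\<lambda>w. g (\<Sum>i=1..k. X i w)) \<in> H \<and>
    E (\<lambda>w. f (\<Sum>i=1..Suc k. X i w)) = E (\<lambda>w. g (\<Sum>i=1..k. X i w))"
  proof (cases "k = 0")
    \<comment> \<open>\<open>X 1\<close> has no predecessors: the empty sum is 0, and the right-hand
      side is the expectation of the constant \<open>g 0\<close>.\<close>
    case True
    then show ?thesis by (simp add: const_mem E_const g_def)
  next
    case False
    let ?\<phi> = "\<lambda>x. f (\<Sum>i\<in>{1..Suc k}. x i)"
    have sum_upd: "(\<Sum>i\<in>{1..Suc k}. (x(Suc k := y)) i) = (\<Sum>i=1..k. x i) + y"
      for x :: "nat \<Rightarrow> real" and y
      by (simp add: atLeastAtMostSuc_conv)
    have res: "(\<Sum>i=1..m. (\<lambda>j\<in>{1..m}. X j w) i) = (\<Sum>i=1..m. X i w)" for m w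
      by (intro sum.cong) auto
    have res': "(\<Sum>i=1..k. (\<lambda>j\<in>{1..<Suc k}. X j w) i) = (\<Sum>i=1..k. X i w)" for w
      by (intro sum.cong) auto
    have "f \<in> borel_measurable borel" using f(1) by (rule borel_measurable_continuous_onI)
    then have meas: "?\<phi> \<in> borel_measurable (Pi\<^sub>M {1..Suc k} (\<lambda>_. borel))"
      by measurable
    have mem: "(\<lambda>w. ?\<phi> (\<lambda>j\<in>{1..Suc k}. X j w)) \<in> H"
      unfolding res by (rule partial_sum_mem[OF f])
    have mem': "\<forall>x\<in>extensional {1..<Suc k}. (\<lambda>w. ?\<phi> (x(Suc k := X (Suc k) w))) \<in> H"
      unfolding sum_upd using shifted_mem[OF f] by simp
    have "indep_of_previous H E X (Suc k)" using indep False by simp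
    from this[unfolded indep_of_previous_def Let_def, rule_format, OF meas mem bspec[OF mem']]
    show ?thesis unfolding res sum_upd res' g_def by blast
  qed
  then show "(\<lambda>w. g (\<Sum>i=1..k. X i w)) \<in> H"
    and "E (\<lambda>w. f (\<Sum>i=1..Suc k. X i w)) = E (\<lambda>w. g (\<Sum>i=1..k. X i w))" by auto
qed

text \<open>Trading \<open>g\<close> for a continuous \<open>h\<close> of linear growth allows
  iteration, since \<open>h\<close> can take the place of \<open>f\<close> in the next step.\<close>

lemma partial_sum_step_le:
  assumes f: "continuous_on UNIV f" "linear_growth f" and h: "continuous_on UNIV h" "linear_growth h"
    and step: "\<And>t. E (\<lambda>w. f (t + X (Suc k) w)) \<le> h t + e"
  shows "E (\<lambda>w. f (\<Sum>i=1..Suc k. X i w)) \<le> E (\<lambda>w. h (\<Sum>i=1..k. X i w)) + e"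
proof -
  have "E (\<lambda>w. f (\<Sum>i=1..Suc k. X i w)) \<le> E (\<lambda>w. h (\<Sum>i=1..k. X i w) + e)"
    unfolding partial_sum_step(2)[OF f]
    by (intro E_mono add_mem partial_sum_mem[OF h] const_mem partial_sum_step(1)[OF f] step)
  then show ?thesis by (simp only: E_add_const[OF partial_sum_mem[OF h]])
qed

lemma partial_sum_step_ge:
  assumes f: "continuous_on UNIV f" "linear_growth f" and h: "continuous_on UNIV h" "linear_growth h"
    and step: "\<And>t. h t - e \<le> E (\<lambda>w. f (t + X (Suc k) w))"
  shows "E (\<lambda>w. h (\<Sum>i=1..k. X i w)) - e \<le> E (\<lambda>w. f (\<Sum>i=1..Suc k. X i w))"
proof -
  have "E (\<lambda>w. h (\<Sum>i=1..k. X i w) + - e) \<le> E (\<lambda>w. f (\<Sum>i=1..Suc k. X i w))"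
    unfolding partial_sum_step(2)[OF f]
    by (intro E_mono add_mem partial_sum_mem[OF h] const_mem partial_sum_step(1)[OF f])
      (use step in simp)
  then show ?thesis by (simp only: E_add_const[OF partial_sum_mem[OF h]])
qed

section \<open>Distance of the partial sums from the sums of the means\<close>

text \<open>Bounds the expectation of \<open>(X i)\<^sup>2 + q\<^sup>2\<close>: \<open>M\<close> for
  the first summand, \<open>mean_sq_le\<close> for the second.\<close>

definition step_cost :: real where "step_cost = M + (1 + M)\<^sup>2"

lemma E_quadratic_le:
  assumes "i \<ge> 1" "q \<in> {\<mu>l i..\<mu>u i}" "0 < c"
  shows "(\<lambda>w. ((X i w)\<^sup>2 + q\<^sup>2) / c) \<in> H" "E (\<lambda>w. ((X i w)\<^sup>2 + q\<^sup>2) / c) \<le> step_cost / c"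
proof -
  have eq: "(\<lambda>w. ((X i w)\<^sup>2 + q\<^sup>2) / c) = (\<lambda>w. q\<^sup>2 / c + (1 / c) * (X i w)\<^sup>2)"
    by (auto simp: add_divide_distrib)
  show "(\<lambda>w. ((X i w)\<^sup>2 + q\<^sup>2) / c) \<in> H"
    unfolding eq by (intro add_mem const_mem scale_mem sq_mem assms)
  have "E (\<lambda>w. ((X i w)\<^sup>2 + q\<^sup>2) / c) \<le> q\<^sup>2 / c + (1 / c) * M"
    unfolding eq using assms by (intro E_affine_le sq_mem second_moment) auto
  also have "\<dots> \<le> (1 + M)\<^sup>2 / c + (1 / c) * M"
    using mean_sq_le[OF assms(1,2)] assms(3) by (simp add: divide_right_mono)
  finally show "E (\<lambda>w. ((X i w)\<^sup>2 + q\<^sup>2) / c) \<le> step_cost / c"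
    by (simp add: step_cost_def add_divide_distrib)
qed

lemma centered_mem: "i \<ge> 1 \<Longrightarrow> (\<lambda>w. r * (X i w - q)) \<in> H"
  using scale_mem[OF add_mem[OF X_mem const_mem], of i r "- q"] by simp

text \<open>Induction in which each step costs at most \<open>step_cost / c\<close>. The past value
  \<open>t\<close> is frozen, so \<open>p\<close> and \<open>q\<close> may depend on it.\<close>

lemma E_soft_dist_le:
  assumes c: "0 < c"
  shows "E (\<lambda>w. soft_dist c {(\<Sum>i=1..n. \<mu>l i)..(\<Sum>i=1..n. \<mu>u i)} (\<Sum>i=1..n. X i w))
    \<le> c + real n * (step_cost / c)"
proof (induction n)
  \<comment> \<open>Sums and interval reduce to 0, where \<open>soft_dist\<close> has the value
    \<open>c\<close>.\<close>
  case 0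
  then show ?case using c by (simp add: soft_dist_def E_const)
next
  case (Suc k)
  let ?I = "\<lambda>k. {(\<Sum>i=1..k. \<mu>l i)..(\<Sum>i=1..k. \<mu>u i)}"
  have le: "(\<Sum>i=1..k. \<mu>l i) \<le> (\<Sum>i=1..k. \<mu>u i)" for k
    by (intro sum_mono means_le) auto
  then have lg: "linear_growth (soft_dist c (?I k))" for k
    by (intro linear_growth_soft_dist) simp
  have "E (\<lambda>w. soft_dist c (?I (Suc k)) (t + X (Suc k) w)) \<le> soft_dist c (?I k) t + step_cost / c" for t
  proof -
    obtain p where p: "p \<in> ?I k" and tp: "infdist t (?I k) = \<bar>t - p\<bar>"
      using infdist_interval_attained[OF le] by blast
    define u where "u = sqrt (c\<^sup>2 + (t - p)\<^sup>2)"
    have u0: "0 < u" unfolding u_def using c by (simp add: add_pos_nonneg)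
    have su: "soft_dist c (?I k) t = u" unfolding soft_dist_def tp u_def by simp
    define r where "r = (t - p) / u"
    \<comment> \<open>This choice makes \<open>E_centered_extreme\<close> applicable, while
      \<open>p + q\<close> still lies in the next interval.\<close>
    define q where "q = (if 0 \<le> r then \<mu>u (Suc k) else \<mu>l (Suc k))"
    have q: "q \<in> {\<mu>l (Suc k)..\<mu>u (Suc k)}" using means_le[of "Suc k"] by (simp add: q_def)
    have pq: "p + q \<in> ?I (Suc k)" using p q by auto
    have mem1: "(\<lambda>w. r * (X (Suc k) w - q)) \<in> H" by (rule centered_mem) simp
    note quad = E_quadratic_le[OF _ q c]
    have "E (\<lambda>w. soft_dist c (?I (Suc k)) (t + X (Suc k) w))
        \<le> E (\<lambda>w. (r * (X (Suc k) w - q) + ((X (Suc k) w)\<^sup>2 + q\<^sup>2) / c) + u)"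
    proof (rule E_mono)
      show "(\<lambda>w. (r * (X (Suc k) w - q) + ((X (Suc k) w)\<^sup>2 + q\<^sup>2) / c) + u) \<in> H"
        using mem1 quad(1) by (intro add_mem const_mem) auto
      show "(\<lambda>w. soft_dist c (?I (Suc k)) (t + X (Suc k) w)) \<in> H"
        by (rule shifted_mem[OF continuous_on_soft_dist lg]) simp
      show "soft_dist c (?I (Suc k)) (t + X (Suc k) w)
          \<le> (r * (X (Suc k) w - q) + ((X (Suc k) w)\<^sup>2 + q\<^sup>2) / c) + u" for w
        using soft_dist_step[OF c pq u_def, of "X (Suc k) w"] unfolding r_def by linarith
    qed
    also have "\<dots> = E (\<lambda>w. r * (X (Suc k) w - q) + ((X (Suc k) w)\<^sup>2 + q\<^sup>2) / c) + u"
      using mem1 quad(1) by (intro E_add_const add_mem) auto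
    also have "E (\<lambda>w. r * (X (Suc k) w - q) + ((X (Suc k) w)\<^sup>2 + q\<^sup>2) / c)
        \<le> E (\<lambda>w. r * (X (Suc k) w - q)) + E (\<lambda>w. ((X (Suc k) w)\<^sup>2 + q\<^sup>2) / c)"
      using mem1 quad(1) by (intro E_add_le) auto
    also have "E (\<lambda>w. r * (X (Suc k) w - q)) = 0"
      by (rule E_centered_extreme) (auto simp: q_def X_mem upper_mean lower_mean)
    also have "E (\<lambda>w. ((X (Suc k) w)\<^sup>2 + q\<^sup>2) / c) \<le> step_cost / c" using quad(2) by simp
    finally show ?thesis unfolding su by linarith
  qed
  from partial_sum_step_le[OF continuous_on_soft_dist lg continuous_on_soft_dist lg this] Suc.IH
  show ?case unfolding of_nat_Suc distrib_right by linarith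
qed

text \<open>Equivalently, an upper bound on the conjugate expectation of the distance to one point.
  The means \<open>q\<close> are prescribed without regard to \<open>t\<close>;
  \<open>E_centered_ge\<close> handles either sign of the first-order coefficient.\<close>

lemma E_minus_soft_dist_ge:
  assumes c: "0 < c" and q: "\<And>i. i \<ge> 1 \<Longrightarrow> q i \<in> {\<mu>l i..\<mu>u i}"
  shows "- (c + real n * (step_cost / c))
    \<le> E (\<lambda>w. - soft_dist c {(\<Sum>i=1..n. q i)} (\<Sum>i=1..n. X i w))"
proof (induction n)
  case 0
  then show ?case using c by (simp add: soft_dist_def E_const)
next
  case (Suc k)
  let ?I = "\<lambda>k. {(\<Sum>i=1..k. q i)}"
  have lg: "linear_growth (\<lambda>t. - soft_dist c (?I k) t)" for k
    by (intro linear_growth_minus linear_growth_soft_dist) simp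
  have ct: "continuous_on UNIV (\<lambda>t. - soft_dist c (?I k) t)" for k
    by (intro continuous_on_minus continuous_on_soft_dist)
  have "- soft_dist c (?I k) t - step_cost / c \<le> E (\<lambda>w. - soft_dist c (?I (Suc k)) (t + X (Suc k) w))" for t
  proof -
    define p where "p = (\<Sum>i=1..k. q i)"
    define u where "u = sqrt (c\<^sup>2 + (t - p)\<^sup>2)"
    have su: "soft_dist c (?I k) t = u" unfolding soft_dist_def u_def p_def by (simp add: dist_real_def)
    \<comment> \<open>The sign is flipped because \<open>soft_dist_step\<close> is used for the
      negated distance.\<close>
    define r where "r = - ((t - p) / u)"
    let ?q = "q (Suc k)"
    have q': "?q \<in> {\<mu>l (Suc k)..\<mu>u (Suc k)}" by (rule q) simp
    have pq: "p + ?q \<in> ?I (Suc k)" by (simp add: p_def)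
    have mem1: "(\<lambda>w. r * (X (Suc k) w - ?q)) \<in> H" by (rule centered_mem) simp
    note quad = E_quadratic_le[OF _ q' c]
    have mem2: "(\<lambda>w. r * (X (Suc k) w - ?q) - ((X (Suc k) w)\<^sup>2 + ?q\<^sup>2) / c) \<in> H"
      using add_mem[OF mem1 uminus_mem[OF quad(1)]] by simp
    have "0 \<le> E (\<lambda>w. r * (X (Suc k) w - ?q))"
      by (rule E_centered_ge) (use q' in \<open>auto simp: X_mem upper_mean lower_mean\<close>)
    moreover have "E (\<lambda>w. ((X (Suc k) w)\<^sup>2 + ?q\<^sup>2) / c) \<le> step_cost / c" using quad(2) by simp
    ultimately have "- u - step_cost / c
        \<le> E (\<lambda>w. r * (X (Suc k) w - ?q)) - E (\<lambda>w. ((X (Suc k) w)\<^sup>2 + ?q\<^sup>2) / c) + - u"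
      by linarith
    also have "\<dots> \<le> E (\<lambda>w. r * (X (Suc k) w - ?q) - ((X (Suc k) w)\<^sup>2 + ?q\<^sup>2) / c) + - u"
      using E_sub[OF mem1 quad(1)] by simp
    also have "\<dots> = E (\<lambda>w. (r * (X (Suc k) w - ?q) - ((X (Suc k) w)\<^sup>2 + ?q\<^sup>2) / c) + - u)"
      using E_add_const[OF mem2, of "- u"] by simp
    also have "\<dots> \<le> E (\<lambda>w. - soft_dist c (?I (Suc k)) (t + X (Suc k) w))"
    proof (rule E_mono)
      show "(\<lambda>w. - soft_dist c (?I (Suc k)) (t + X (Suc k) w)) \<in> H"
        by (rule shifted_mem[OF ct lg]) simp
      show "(\<lambda>w. (r * (X (Suc k) w - ?q) - ((X (Suc k) w)\<^sup>2 + ?q\<^sup>2) / c) + - u) \<in> H"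
        by (rule add_mem[OF mem2 const_mem])
      show "(r * (X (Suc k) w - ?q) - ((X (Suc k) w)\<^sup>2 + ?q\<^sup>2) / c) + - u
          \<le> - soft_dist c (?I (Suc k)) (t + X (Suc k) w)" for w
        using soft_dist_step[OF c pq u_def, of "X (Suc k) w"] unfolding r_def by simp
    qed
    finally show ?thesis unfolding su .
  qed
  from partial_sum_step_ge[OF ct lg ct lg this] Suc.IH
  show ?case unfolding of_nat_Suc distrib_right by linarith
qed

section \<open>Quantitative bounds for the averages\<close>

text \<open>\<open>infdist_mean_le\<close> splits the distance in the majorant into a deterministic
  deviation and a random part, which \<open>E_soft_dist_le\<close> controls with
  \<open>c = sqrt (real n)\<close>.\<close>

lemma E_phi_mean_le:
  assumes \<phi>: "continuous_on UNIV \<phi>" "linear_growth \<phi>" and n: "n \<ge> 1" and ab: "ml \<le> mu"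
    and K: "0 \<le> K" "\<And>y. \<phi> y \<le> m + K * infdist y {ml..mu}"
  shows "E (\<lambda>w. \<phi> ((1 / real n) * (\<Sum>i=1..n. X i w)))
    \<le> m + K * ((1 / real n) * (\<Sum>i=1..n. \<bar>\<mu>l i - ml\<bar>) + (1 / real n) * (\<Sum>i=1..n. \<bar>\<mu>u i - mu\<bar>)
        + (1 + step_cost) / sqrt (real n))"
proof -
  define A where "A = (1 / real n) * (\<Sum>i=1..n. \<bar>\<mu>l i - ml\<bar>) + (1 / real n) * (\<Sum>i=1..n. \<bar>\<mu>u i - mu\<bar>)"
  let ?S = "\<lambda>w. \<Sum>i=1..n. X i w"
  let ?D = "soft_dist (sqrt (real n)) {(\<Sum>i=1..n. \<mu>l i)..(\<Sum>i=1..n. \<mu>u i)}"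
  have le: "(\<Sum>i=1..n. \<mu>l i) \<le> (\<Sum>i=1..n. \<mu>u i)"
    by (intro sum_mono means_le) auto
  have D_mem: "(\<lambda>w. ?D (?S w)) \<in> H"
    using le by (intro partial_sum_mem continuous_on_soft_dist linear_growth_soft_dist) simp
  have "E (\<lambda>w. \<phi> ((1 / real n) * ?S w)) \<le> E (\<lambda>w. (m + K * A) + (K / real n) * ?D (?S w))"
  proof (rule E_mono)
    show "(\<lambda>w. (m + K * A) + (K / real n) * ?D (?S w)) \<in> H"
      by (intro add_mem const_mem scale_mem D_mem)
    show "(\<lambda>w. \<phi> ((1 / real n) * ?S w)) \<in> H" by (rule mean_mem[OF \<phi>])
    fix w
    have "\<phi> ((1 / real n) * ?S w) \<le> m + K * infdist ((1 / real n) * ?S w) {ml..mu}" by (rule K)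
    also have "\<dots> \<le> m + K * (A + ?D (?S w) / real n)"
      using infdist_mean_le[OF n ab le] K(1) unfolding A_def
      by (intro add_left_mono mult_left_mono) auto
    finally show "\<phi> ((1 / real n) * ?S w) \<le> (m + K * A) + (K / real n) * ?D (?S w)"
      by (simp add: algebra_simps)
  qed
  also have "\<dots> \<le> (m + K * A) + (K / real n) * (sqrt (real n) + real n * (step_cost / sqrt (real n)))"
    using n K(1) by (intro E_affine_le D_mem E_soft_dist_le) auto
  also have "\<dots> = m + K * (A + (1 + step_cost) / sqrt (real n))"
    using sqrt_scaling[OF n, of K step_cost] by (simp add: algebra_simps)
  finally show ?thesis unfolding A_def .
qed

text \<open>Dividing every interval of means in the ratio \<open>s\<close> gives admissible
  \<open>q i\<close> whose deviations from \<open>y\<close> are bounded by those of the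
  endpoints.\<close>

lemma E_phi_mean_ge:
  assumes \<phi>: "continuous_on UNIV \<phi>" "linear_growth \<phi>" and n: "n \<ge> 1"
    and y: "y = (1 - s) * ml + s * mu" and s: "0 \<le> s" "s \<le> 1"
    and K: "0 \<le> K" "\<And>x. m - K * \<bar>x - y\<bar> \<le> \<phi> x"
  shows "m - K * (2 * ((1 / real n) * (\<Sum>i=1..n. \<bar>\<mu>l i - ml\<bar>) + (1 / real n) * (\<Sum>i=1..n. \<bar>\<mu>u i - mu\<bar>))
        + (1 + step_cost) / sqrt (real n))
    \<le> E (\<lambda>w. \<phi> ((1 / real n) * (\<Sum>i=1..n. X i w)))"
proof -
  define A where "A = (1 / real n) * (\<Sum>i=1..n. \<bar>\<mu>l i - ml\<bar>) + (1 / real n) * (\<Sum>i=1..n. \<bar>\<mu>u i - mu\<bar>)"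
  define q where "q i = (1 - s) * \<mu>l i + s * \<mu>u i" for i
  have q: "q i \<in> {\<mu>l i..\<mu>u i}" if "i \<ge> 1" for i
  proof -
    have "0 \<le> s * (\<mu>u i - \<mu>l i)" "0 \<le> (1 - s) * (\<mu>u i - \<mu>l i)"
      using s means_le[OF that] by (auto intro: mult_nonneg_nonneg)
    then show ?thesis by (simp add: q_def algebra_simps)
  qed
  have "\<bar>q i - y\<bar> \<le> \<bar>\<mu>l i - ml\<bar> + \<bar>\<mu>u i - mu\<bar>" for i
  proof -
    have "q i - y = (1 - s) * (\<mu>l i - ml) + s * (\<mu>u i - mu)" by (simp add: q_def y algebra_simps)
    also have "\<bar>\<dots>\<bar> \<le> \<bar>(1 - s) * (\<mu>l i - ml)\<bar> + \<bar>s * (\<mu>u i - mu)\<bar>" by (rule abs_triangle_ineq)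
    also have "\<dots> \<le> \<bar>\<mu>l i - ml\<bar> + \<bar>\<mu>u i - mu\<bar>"
      using s by (intro add_mono) (auto simp: abs_mult mult_left_le_one_le)
    finally show ?thesis .
  qed
  then have "(\<Sum>i=1..n. \<bar>q i - y\<bar>) \<le> (\<Sum>i=1..n. \<bar>\<mu>l i - ml\<bar>) + (\<Sum>i=1..n. \<bar>\<mu>u i - mu\<bar>)"
    by (simp add: sum_mono flip: sum.distrib)
  then have qA: "(1 / real n) * (\<Sum>i=1..n. \<bar>q i - y\<bar>) \<le> A"
    unfolding A_def by (simp add: divide_right_mono flip: add_divide_distrib)
  let ?S = "\<lambda>w. \<Sum>i=1..n. X i w"
  let ?D = "soft_dist (sqrt (real n)) {\<Sum>i=1..n. q i}"
  have D_mem: "(\<lambda>w. - ?D (?S w)) \<in> H"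
    by (intro uminus_mem partial_sum_mem continuous_on_soft_dist linear_growth_soft_dist) simp
  have "m - K * (2 * A + (1 + step_cost) / sqrt (real n))
      = (m - K * (2 * A)) + (K / real n) * - (sqrt (real n) + real n * (step_cost / sqrt (real n)))"
    using sqrt_scaling[OF n, of K step_cost] by (simp add: algebra_simps)
  also have "\<dots> \<le> (m - K * (2 * A)) + (K / real n) * E (\<lambda>w. - ?D (?S w))"
    using n K(1) by (intro add_left_mono mult_left_mono E_minus_soft_dist_ge q) auto
  also have "\<dots> = E (\<lambda>w. (m - K * (2 * A)) + (K / real n) * - ?D (?S w))"
    using K(1) by (intro E_affine[symmetric] D_mem) simp
  also have "\<dots> \<le> E (\<lambda>w. \<phi> ((1 / real n) * ?S w))"
  proof (rule E_mono)
    show "(\<lambda>w. (m - K * (2 * A)) + (K / real n) * - ?D (?S w)) \<in> H"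
      by (intro add_mem const_mem scale_mem D_mem)
    show "(\<lambda>w. \<phi> ((1 / real n) * ?S w)) \<in> H" by (rule mean_mem[OF \<phi>])
    fix w
    \<comment> \<open>Both endpoint sequences are \<open>q\<close> and the target is
      \<open>{y..y}\<close>, so the two deviation sums coincide; hence the factor 2.\<close>
    have "\<bar>(1 / real n) * ?S w - y\<bar> \<le> 2 * A + ?D (?S w) / real n"
      using infdist_mean_le[OF n, of y y q q "?S w" "sqrt (real n)"] qA by (simp add: dist_real_def)
    then have "m - K * (2 * A + ?D (?S w) / real n) \<le> m - K * \<bar>(1 / real n) * ?S w - y\<bar>"
      using K(1) by (intro diff_left_mono mult_left_mono)
    also have "\<dots> \<le> \<phi> ((1 / real n) * ?S w)" by (rule K)
    finally show "(m - K * (2 * A)) + (K / real n) * - ?D (?S w) \<le> \<phi> ((1 / real n) * ?S w)"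
      by (simp add: algebra_simps)
  qed
  finally show ?thesis unfolding A_def .
qed

end

section \<open>Passage to the limit\<close>

theorem theorem3p1:
  fixes H :: "('w \<Rightarrow> real) set"
    and E :: "('w \<Rightarrow> real) \<Rightarrow> real"
    and F :: "'w set set"
    and X :: "nat \<Rightarrow> 'w \<Rightarrow> real"
    and \<mu>l \<mu>u :: "nat \<Rightarrow> real"
    and ml mu :: real
    and \<phi> :: "real \<Rightarrow> real"
  assumes "sublinear_expectation_space H E"
    and "sigma_algebra UNIV F"
    and "upper_continuous_capacity F (capacity_of E)"
    and "\<And>i. i \<ge> 1 \<Longrightarrow> X i \<in> H"
    and "\<And>i. i \<ge> 1 \<Longrightarrow> X i \<in> borel_measurable (sigma UNIV F)"
    and "rich_for F H X"
    and "\<And>i. i \<ge> 1 \<Longrightarrow> indep_of_previous H E X (Suc i)"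
    and "\<And>i. i \<ge> 1 \<Longrightarrow> E (X i) = \<mu>u i"
    and "\<And>i. i \<ge> 1 \<Longrightarrow> conj_expectation E (X i) = \<mu>l i"
    and "\<And>i. i \<ge> 1 \<Longrightarrow> \<mu>l i \<le> \<mu>u i"
    and "(\<lambda>n. (1 / real n) * (\<Sum>i=1..n. \<bar>\<mu>l i - ml\<bar>)) \<longlonglongrightarrow> 0"
    and "(\<lambda>n. (1 / real n) * (\<Sum>i=1..n. \<bar>\<mu>u i - mu\<bar>)) \<longlonglongrightarrow> 0"
    and "bdd_above ((\<lambda>i. E (\<lambda>w. \<bar>X i w\<bar>\<^sup>2)) ` {1..})"
    and "continuous_on UNIV \<phi>"
    and "linear_growth \<phi>"
  shows "(\<lambda>n. E (\<lambda>w. \<phi> ((1 / real n) * (\<Sum>i=1..n. X i w))))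
           \<longlonglongrightarrow> (SUP y\<in>{ml..mu}. \<phi> y)"
proof -
  note \<phi> = assms(14,15)
  obtain M where M: "\<And>i. i \<ge> 1 \<Longrightarrow> E (\<lambda>w. \<bar>X i w\<bar>\<^sup>2) \<le> M"
    using assms(13) unfolding bdd_above_def by (auto simp: image_iff)
  interpret sublinear_expectation_space H E by (rule assms(1))
  interpret independent_sequence H E F X \<mu>l \<mu>u M
    by unfold_locales (use assms(4,6-10) M in auto)
  define \<alpha> where "\<alpha> n = (1 / real n) * (\<Sum>i=1..n. \<bar>\<mu>l i - ml\<bar>) + (1 / real n) * (\<Sum>i=1..n. \<bar>\<mu>u i - mu\<bar>)" for n
  have \<alpha>: "\<alpha> \<longlonglongrightarrow> 0"
    using tendsto_add[OF assms(11,12)] unfolding \<alpha>_def by simp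
  have root: "(\<lambda>n. (1 + step_cost) / sqrt (real n)) \<longlonglongrightarrow> 0"
    by (intro tendsto_divide_0[OF tendsto_const] filterlim_at_top_imp_at_infinity
        filterlim_compose[OF sqrt_at_top filterlim_real_sequentially])
  \<comment> \<open>The order of the limits is inherited from that of the \<open>\<mu>l i\<close>
    and \<open>\<mu>u i\<close> by averaging and letting \<open>n\<close> grow.\<close>
  have le: "ml \<le> mu"
  proof -
    have "ml - mu \<le> \<alpha> n" if n: "n \<ge> 1" for n
    proof -
      have "(\<Sum>i=1..n. ml - mu) \<le> (\<Sum>i=1..n. \<bar>\<mu>l i - ml\<bar> + \<bar>\<mu>u i - mu\<bar>)"
      proof (rule sum_mono)
        fix i assume "i \<in> {1..n}"
        then show "ml - mu \<le> \<bar>\<mu>l i - ml\<bar> + \<bar>\<mu>u i - mu\<bar>" using assms(10)[of i] by simp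
      qed
      then have "(ml - mu) * real n \<le> (\<Sum>i=1..n. \<bar>\<mu>l i - ml\<bar>) + (\<Sum>i=1..n. \<bar>\<mu>u i - mu\<bar>)"
        by (simp add: sum.distrib mult.commute)
      then show ?thesis using n unfolding \<alpha>_def
        by (simp add: pos_le_divide_eq flip: add_divide_distrib)
    qed
    then have "ml - mu \<le> 0"
      by (intro tendsto_lowerbound[OF \<alpha>] eventually_sequentiallyI[of 1]) auto
    then show ?thesis by simp
  qed
  obtain y where y: "y \<in> {ml..mu}" and ymax: "\<And>x. x \<in> {ml..mu} \<Longrightarrow> \<phi> x \<le> \<phi> y"
    using continuous_attains_sup[of "{ml..mu}" \<phi>] le continuous_on_subset[OF \<phi>(1)] by auto
  have sup: "(SUP y\<in>{ml..mu}. \<phi> y) = \<phi> y"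
    using y ymax by (intro cSup_eq_maximum) auto
  obtain s where s: "0 \<le> s" "s \<le> 1" "y = (1 - s) * ml + s * mu"
    using y le unfolding closed_segment_eq_real_ivl1[OF le, symmetric] in_segment by auto
  let ?e = "\<lambda>n. E (\<lambda>w. \<phi> ((1 / real n) * (\<Sum>i=1..n. X i w)))"
  show ?thesis unfolding sup
  proof (rule order_tendstoI)
    fix a assume "\<phi> y < a"
    \<comment> \<open>Half of the gap goes to the majorant, the other half absorbs the vanishing
      errors.\<close>
    define \<epsilon> where "\<epsilon> = (a - \<phi> y) / 2"
    have \<epsilon>: "0 < \<epsilon>" using \<open>\<phi> y < a\<close> by (simp add: \<epsilon>_def)
    obtain K where K: "0 \<le> K" "\<And>x. \<phi> x \<le> \<phi> y + \<epsilon> + K * infdist x {ml..mu}"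
      using majorant_infdist[OF \<phi> le ymax \<epsilon>] by blast
    have "(\<lambda>n. \<phi> y + \<epsilon> + K * (\<alpha> n + (1 + step_cost) / sqrt (real n))) \<longlonglongrightarrow> \<phi> y + \<epsilon> + K * (0 + 0)"
      by (intro tendsto_intros \<alpha> root)
    moreover have "\<phi> y + \<epsilon> + K * (0 + 0) < a" using \<open>\<phi> y < a\<close> by (simp add: \<epsilon>_def field_simps)
    ultimately have "\<forall>\<^sub>F n in sequentially. \<phi> y + \<epsilon> + K * (\<alpha> n + (1 + step_cost) / sqrt (real n)) < a"
      by (rule order_tendstoD)
    \<comment> \<open>The estimates need \<open>n\<close> \<ge> 1; at 0 the factor
      \<open>1 / real n\<close> is 0 by convention.\<close>
    with eventually_ge_at_top[of 1] show "\<forall>\<^sub>F n in sequentially. ?e n < a"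
    proof eventually_elim
      case (elim n)
      from E_phi_mean_le[OF \<phi> elim(1) le K] elim(2) show ?case unfolding \<alpha>_def by linarith
    qed
  next
    fix a assume "a < \<phi> y"
    define \<epsilon> where "\<epsilon> = (\<phi> y - a) / 2"
    have \<epsilon>: "0 < \<epsilon>" using \<open>a < \<phi> y\<close> by (simp add: \<epsilon>_def)
    \<comment> \<open>The distance to \<open>{y..y}\<close> is \<open>\<bar>x - y\<bar>\<close>, so
      a majorant of the negated function is a minorant of \<open>\<phi>\<close> around
      \<open>y\<close>.\<close>
    obtain K where K: "0 \<le> K" "\<And>x. - \<phi> x \<le> - \<phi> y + \<epsilon> + K * infdist x {y..y}"
      using majorant_infdist[OF continuous_on_minus[OF \<phi>(1)] linear_growth_minus[OF \<phi>(2)], of y y "- \<phi> y"] \<epsilon>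
      by auto
    have K': "(\<phi> y - \<epsilon>) - K * \<bar>x - y\<bar> \<le> \<phi> x" for x
      using K(2)[of x] by (simp add: dist_real_def)
    have "(\<lambda>n. (\<phi> y - \<epsilon>) - K * (2 * \<alpha> n + (1 + step_cost) / sqrt (real n))) \<longlonglongrightarrow> (\<phi> y - \<epsilon>) - K * (2 * 0 + 0)"
      by (intro tendsto_intros \<alpha> root)
    moreover have "a < (\<phi> y - \<epsilon>) - K * (2 * 0 + 0)" using \<open>a < \<phi> y\<close> by (simp add: \<epsilon>_def field_simps)
    ultimately have "\<forall>\<^sub>F n in sequentially. a < (\<phi> y - \<epsilon>) - K * (2 * \<alpha> n + (1 + step_cost) / sqrt (real n))"
      by (rule order_tendstoD)
    with eventually_ge_at_top[of 1] show "\<forall>\<^sub>F n in sequentially. a < ?e n"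
    proof eventually_elim
      case (elim n)
      from E_phi_mean_ge[OF \<phi> elim(1) s(3,1,2) K(1) K'] elim(2) show ?case unfolding \<alpha>_def by linarith
    qed
  qed
qed

end
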